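(* Let $d \ge 2$ and $f \in \mathcal{F}_{[0,1]}$, and let $C_f$ be the copula generated by $f$. For each $j\in\{1,\dots,d\}$ put $\mathcal{V}_j := \{\mathbf{u}\in[0,1]^d : u_j\in(0,1)\}$. Then for each $j \in \{1,\dots,d\}$, the partial derivative $\dot C_{f,j} := \partial C_f/\partial u_j$ exists and is continuous on $\mathcal{V}_j$. If $d\ge 3$, then for each pair $(i,j)\in\{1,\dots,d\}^2$ (including $i=j$), the second order partial derivative $\ddot C_{f,ij} := \partial^2 C_f/\partial u_i\partial u_j$ exists and is continuous on $\mathcal{V}_i\cap\mathcal{V}_j$, and $|\ddot C_{f,ij}(\mathbf{u})|\le 1$ there.
   Context: $\mathcal{F}_{[0,1]}$ denotes the set of probability densities on $[0,1]$ with respect to Lebesgue measure: measurable, non-negative functions on $[0,1]$ (the value $\infty$ is allowed) with integral $1$. For real $x$, $x\bmod 1 := x-\lfloor x\rfloor$. For $f\in\mathcal{F}_{[0,1]}$, $C_f$ is the $d$-dimensional copula (distribution function on $[0,1]^d$ with uniform marginals) with density $c_f(\mathbf{u}) := f\big((\sum_{j=1}^d u_j)\bmod 1\big)$, i.e. $C_f(\mathbf{u})=\int_{[0,u_1]\times\cdots\times[0,u_d]}c_f(\mathbf{v})\,d\mathbf{v}$ for $\mathbf{u}\in[0,1]^d$. *)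

theory Defs
  imports "HOL-Analysis.Analysis"
begin

text \<open>The dimension \<open>d\<close> is the cardinality of the index type \<open>'n\<close>.\<close>

(* Lebesgue measurability is the most general reading of "measurable"; only values on the
   unit interval matter. *)
definition unit_densities :: "(real \<Rightarrow> ennreal) set" where
  "unit_densities =
     {f. f \<in> borel_measurable (lebesgue_on {0..1}) \<and> (\<integral>\<^sup>+x. f x \<partial>lebesgue_on {0..1}) = 1}"

definition copula_density :: "(real \<Rightarrow> ennreal) \<Rightarrow> real ^ 'n::finite \<Rightarrow> ennreal" where
  "copula_density f u = f (frac (\<Sum>j\<in>UNIV. u $ j))"

(* Meaningful for u in the unit cube, where the integral is at most 1, so that enn2real
   loses nothing. *)
definition generated_copula :: "(real \<Rightarrow> ennreal) \<Rightarrow> real ^ 'n::finite \<Rightarrow> real" where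
  "generated_copula f u = enn2real (\<integral>\<^sup>+v\<in>cbox 0 u. copula_density f v \<partial>lebesgue)"

definition coord_line :: "'n \<Rightarrow> real ^ 'n::finite \<Rightarrow> real \<Rightarrow> real ^ 'n" where
  "coord_line j u t = (\<chi> k. if k = j then t else u $ k)"

definition partial_differentiable ::
    "'n \<Rightarrow> (real ^ 'n::finite \<Rightarrow> real) \<Rightarrow> real ^ 'n \<Rightarrow> bool" where
  "partial_differentiable j F u \<longleftrightarrow> (\<lambda>t. F (coord_line j u t)) differentiable (at (u $ j))"

definition partial_deriv ::
    "'n \<Rightarrow> (real ^ 'n::finite \<Rightarrow> real) \<Rightarrow> real ^ 'n \<Rightarrow> real" where
  "partial_deriv j F u = deriv (\<lambda>t. F (coord_line j u t)) (u $ j)"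

(* For u in this set, the line through u in direction j stays in the unit cube near u, so
   partial derivatives in direction j are two-sided and depend on the cube only. *)
definition open_in_coord :: "'n \<Rightarrow> (real ^ 'n::finite) set" where
  "open_in_coord j = {u. (\<forall>k. u $ k \<in> {0..1}) \<and> u $ j \<in> {0<..<1}}"

end

theory Submission
  imports Defs
begin

text \<open>
  After a change on a null set, \<open>f\<close> is a finite Borel function.  Extend it to the periodic function
  \<open>h s = f (s mod 1)\<close>, let \<open>P 0 x\<close> be the integral of \<open>h\<close> from \<open>0\<close> to \<open>x\<close> for \<open>x \<ge> 0\<close>, and let
  \<open>P (k + 1)\<close> be a primitive of \<open>P k\<close>.  Integrating \<open>h (v\<^sub>1 + \<dots> + v\<^sub>d)\<close> over the box
  \<open>[0, u\<^sub>1] \<times> \<dots> \<times> [0, u\<^sub>d]\<close> one coordinate at a time gives the mixed difference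
  \<open>C u = (\<Sum>S. (-1) ^ (d - \<bar>S\<bar>) * P (d - 1) (\<Sum>k\<in>S. u\<^sub>k))\<close>,
  where \<open>S\<close> ranges over the sets of coordinates
  (\<open>nn_integral_box_sum\<close>, \<open>generated_copula_eq_mixed_difference\<close>).
  The function \<open>P 0\<close> is continuous, so that \<open>P (d - 1)\<close> has \<open>d - 1\<close> continuous derivatives.
  Hence the first partial derivatives, which are mixed differences of \<open>P (d - 2)\<close>, exist
  and are continuous for \<open>d \<ge> 2\<close>, and the second ones, mixed differences of \<open>P (d - 3)\<close>,
  for \<open>d \<ge> 3\<close>.

  For the bound, a mixed difference of \<open>P k\<close> over \<open>k + 1\<close> coordinates with steps in \<open>[0, 1]\<close>
  and a nonnegative base point lies in \<open>[0, 1]\<close> (\<open>mixed_difference_bounds\<close>).  For \<open>k = 0\<close> this is the integral of \<open>h\<close> over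
  an interval no longer than a period; by the mean value
  theorem, each further coordinate multiplies a value of the preceding mixed difference by a
  step in \<open>[0, 1]\<close>.  For \<open>i \<noteq> j\<close> the derivative in
  \<open>i\<close> and \<open>j\<close> is such a mixed difference over the remaining \<open>d - 2\<close> coordinates; the
  second derivative in \<open>j\<close> alone is the difference of two of them, which is still at most \<open>1\<close>
  in absolute value.
\<close>

section \<open>Mixed differences\<close>

text \<open>
  The result of applying to \<open>G\<close> the forward differences with steps \<open>w a\<close>, for all \<open>a \<in> A\<close>,
  evaluated at \<open>x\<close>.  It is written out as a sum over subsets; \<open>mixed_difference_insert\<close> is the
  recursion that takes one difference at a time.
\<close>
definition mixed_difference :: "'i set \<Rightarrow> ('i \<Rightarrow> real) \<Rightarrow> (real \<Rightarrow> real) \<Rightarrow> real \<Rightarrow> real" where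
  "mixed_difference A w G x = (\<Sum>S\<in>Pow A. (-1) ^ card (A - S) * G (x + sum w S))"

lemma mixed_difference_empty [simp]: "mixed_difference {} w G x = G x"
  by (simp add: mixed_difference_def)

lemma mixed_difference_insert:
  assumes "finite A" "a \<notin> A"
  shows "mixed_difference (insert a A) w G x =
           mixed_difference A w G (x + w a) - mixed_difference A w G x"
proof -
  have inj: "inj_on (insert a) (Pow A)"
    using assms(2) by (auto simp: inj_on_def insert_ident)
  have disj: "Pow A \<inter> insert a ` Pow A = {}"
    using assms(2) by auto
  have without_a: "(-1) ^ card (insert a A - S) * G (x + sum w S) =
                   - ((-1::real) ^ card (A - S) * G (x + sum w S))" if "S \<in> Pow A" for S
  proof -
    have "insert a A - S = insert a (A - S)"
      using that assms(2) by auto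
    then show ?thesis
      using assms by simp
  qed
  have with_a: "(-1) ^ card (insert a A - insert a S) * G (x + sum w (insert a S)) =
                (-1::real) ^ card (A - S) * G (x + w a + sum w S)" if "S \<in> Pow A" for S
  proof -
    have "insert a A - insert a S = A - S" "finite S" "a \<notin> S"
      using that assms by (auto intro: finite_subset)
    then show ?thesis
      by (simp add: algebra_simps)
  qed
  have "mixed_difference (insert a A) w G x =
          (\<Sum>S\<in>Pow A. (-1) ^ card (insert a A - S) * G (x + sum w S)) +
          (\<Sum>S\<in>Pow A. (-1) ^ card (insert a A - insert a S) * G (x + sum w (insert a S)))"
    unfolding mixed_difference_def Pow_insert
    using assms inj disj by (subst sum.union_disjoint) (auto simp: sum.reindex)
  also have "\<dots> = - mixed_difference A w G x + mixed_difference A w G (x + w a)"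
    unfolding mixed_difference_def
    using sum.cong[OF refl without_a, of "Pow A"] sum.cong[OF refl with_a, of "Pow A"]
    by (simp only: sum_negf)
  finally show ?thesis
    by simp
qed

lemma mixed_difference_cong:
  assumes "\<And>a. a \<in> A \<Longrightarrow> w a = v a"
  shows "mixed_difference A w G x = mixed_difference A v G x"
  unfolding mixed_difference_def
proof (rule sum.cong[OF refl])
  fix S assume "S \<in> Pow A"
  then have "sum w S = sum v S"
    using assms by (intro sum.cong) auto
  then show "(-1) ^ card (A - S) * G (x + sum w S) = (-1) ^ card (A - S) * G (x + sum v S)"
    by simp
qed

lemma mixed_difference_image:
  assumes "finite A" "inj_on g A"
  shows "mixed_difference (g ` A) w G x = mixed_difference A (\<lambda>a. w (g a)) G x"
  using assms
proof (induction A arbitrary: x rule: finite_induct)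
  case (insert a A)
  then show ?case
    by (simp add: mixed_difference_insert)
qed simp

lemma DERIV_mixed_difference:
  assumes "\<And>y. (G has_real_derivative G' y) (at y)"
  shows "(mixed_difference A w G has_real_derivative mixed_difference A w G' x) (at x)"
proof -
  have "((\<lambda>x. G (x + c)) has_real_derivative G' (x + c)) (at x)" for c
    using DERIV_shift[of G "G' (x + c)" x c] assms by simp
  then show ?thesis
    unfolding mixed_difference_def [abs_def] by (intro DERIV_sum DERIV_cmult)
qed

lemma continuous_on_mixed_difference:
  assumes "continuous_on UNIV G" "continuous_on S x" "\<And>a. a \<in> A \<Longrightarrow> continuous_on S (\<lambda>u. w u a)"
  shows "continuous_on S (\<lambda>u. mixed_difference A (w u) G (x u))"
  unfolding mixed_difference_def
  by (intro continuous_intros continuous_on_compose2[OF assms(1)] assms(2,3)) auto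

section \<open>Chains of primitives\<close>

text \<open>
  Each \<open>P (k + 1)\<close> is a primitive of \<open>P k\<close>; the first function \<open>P 0\<close> is only
  continuous, and on the nonnegative half-line it is nondecreasing and grows by at most \<open>1\<close> over
  intervals of length at most \<open>1\<close>.  The application is to the iterated primitives of a periodic
  density.
\<close>
locale primitive_chain =
  fixes P :: "nat \<Rightarrow> real \<Rightarrow> real"
  assumes P_Suc: "\<And>k x. (P (Suc k) has_real_derivative P k x) (at x)"
    and P_0_cont: "continuous_on UNIV (P 0)"
    and P_0_increment: "\<And>x w. 0 \<le> x \<Longrightarrow> 0 \<le> w \<Longrightarrow> w \<le> 1 \<Longrightarrow> P 0 (x + w) - P 0 x \<in> {0..1}"
begin

lemma P_cont: "continuous_on UNIV (P k)"
  by (cases k) (use P_0_cont P_Suc in \<open>auto intro: DERIV_continuous_on\<close>)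

lemma mixed_difference_bounds:
  assumes "finite A" "card A = Suc k" "\<And>a. a \<in> A \<Longrightarrow> w a \<in> {0..1}" "0 \<le> x"
  shows "mixed_difference A w (P k) x \<in> {0..1}"
  using assms
proof (induction k arbitrary: A x)
  case 0
  then obtain a where "A = {a}"
    by (auto simp: card_Suc_eq)
  then show ?case
    using 0 P_0_increment[of x "w a"] by (simp add: mixed_difference_insert)
next
  case (Suc k)
  obtain a B where A: "A = insert a B" "a \<notin> B" "card B = Suc k" "finite B"
    using Suc.prems(1,2) by (metis card_Suc_eq finite_insert)
  let ?D = "mixed_difference B w (P (Suc k))"
  have wa: "0 \<le> w a" "w a \<le> 1"
    using Suc.prems(3)[of a] A by auto
  have eq: "mixed_difference A w (P (Suc k)) x = ?D (x + w a) - ?D x"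
    using A by (simp add: mixed_difference_insert)
  show ?case
  proof (cases "w a = 0")
    case False
    then have "x < x + w a"
      using wa by simp
    from MVT2[OF this DERIV_mixed_difference[OF P_Suc], of B w k]
    obtain z where z: "x < z" "?D (x + w a) - ?D x = w a * mixed_difference B w (P k) z"
      by auto
    moreover have "mixed_difference B w (P k) z \<in> {0..1}"
      using A Suc.prems z by (intro Suc.IH) auto
    ultimately show ?thesis
      unfolding eq using wa by (auto intro: mult_le_one)
  qed (simp add: eq)
qed

end

section \<open>Partial derivatives of mixed differences\<close>

lemma coord_line_nth [simp]: "coord_line j u t $ k = (if k = j then t else u $ k)"
  by (simp add: coord_line_def)

lemma coord_line_self [simp]: "coord_line j u (u $ j) = u"
  by (simp add: vec_eq_iff)

lemma eventually_coord_line_open_in_coord: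
  assumes "u \<in> open_in_coord i \<inter> open_in_coord j"
  shows "\<forall>\<^sub>F t in nhds (u $ i). coord_line i u t \<in> open_in_coord i \<inter> open_in_coord j"
proof -
  have "\<forall>\<^sub>F t in nhds (u $ i). t \<in> {0<..<1}"
    using assms by (intro eventually_nhds_in_open) (auto simp: open_in_coord_def)
  then show ?thesis
    by eventually_elim (use assms in \<open>auto simp: open_in_coord_def\<close>)
qed

lemma partial_derivI:
  assumes "\<forall>\<^sub>F t in nhds (u $ j). F (coord_line j u t) = \<phi> t"
    and "(\<phi> has_real_derivative D) (at (u $ j))"
  shows "partial_differentiable j F u" "partial_deriv j F u = D"
proof -
  have "((\<lambda>t. F (coord_line j u t)) has_real_derivative D) (at (u $ j))"
    using DERIV_cong_ev[OF refl assms(1) refl] assms(2) by simp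
  then show "partial_differentiable j F u" "partial_deriv j F u = D"
    unfolding partial_differentiable_def partial_deriv_def
    by (auto intro: DERIV_imp_deriv real_differentiable_def[THEN iffD2])
qed

context primitive_chain
begin

text \<open>
  Only the subsets that contain \<open>j\<close> depend on \<open>u $ j\<close>, so one difference disappears: the
  function is \<open>D (u $ j) - D 0\<close> with \<open>D\<close> a mixed difference over the other coordinates.
\<close>
lemma partial_deriv_of_mixed_difference:
  fixes F :: "real ^ 'n::finite \<Rightarrow> real"
  assumes F: "\<And>u. (\<And>k. u $ k \<in> {0..1}) \<Longrightarrow> F u = mixed_difference UNIV (($) u) (P (Suc m)) 0"
    and u: "u \<in> open_in_coord j"
  shows "partial_differentiable j F u"
    and "partial_deriv j F u = mixed_difference (UNIV - {j}) (($) u) (P m) (u $ j)"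
proof -
  let ?D = "mixed_difference (UNIV - {j}) (($) u) (P (Suc m))"
  \<comment> \<open>On the line in direction \<open>j\<close> the steps in the other coordinates are those of \<open>u\<close>.\<close>
  have "F v = ?D (v $ j) - ?D 0" if "v = coord_line j u t" "v \<in> open_in_coord j" for v t
  proof -
    have "F v = mixed_difference (insert j (UNIV - {j})) (($) v) (P (Suc m)) 0"
      using F[of v] that(2) by (simp add: open_in_coord_def insert_absorb)
    also have "\<dots> = mixed_difference (UNIV - {j}) (($) v) (P (Suc m)) (v $ j) -
                    mixed_difference (UNIV - {j}) (($) v) (P (Suc m)) 0"
      by (subst mixed_difference_insert) simp_all
    also have "\<dots> = ?D (v $ j) - ?D 0"
      using that(1) by (intro arg_cong2[where f = "(-)"] mixed_difference_cong) auto
    finally show ?thesis .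
  qed
  then have "\<forall>\<^sub>F t in nhds (u $ j). F (coord_line j u t) = ?D t - ?D 0"
    using eventually_coord_line_open_in_coord[of u j j] u
    by (auto elim!: eventually_mono)
  moreover have "((\<lambda>t. ?D t - ?D 0) has_real_derivative
                   mixed_difference (UNIV - {j}) (($) u) (P m) (u $ j)) (at (u $ j))"
    by (auto intro!: derivative_eq_intros DERIV_mixed_difference P_Suc)
  ultimately show "partial_differentiable j F u"
    and "partial_deriv j F u = mixed_difference (UNIV - {j}) (($) u) (P m) (u $ j)"
    by (rule partial_derivI)+
qed

lemma second_partial_deriv_same:
  fixes F' :: "real ^ 'n::finite \<Rightarrow> real"
  assumes F': "\<And>u. u \<in> open_in_coord j \<Longrightarrow>
                 F' u = mixed_difference (UNIV - {j}) (($) u) (P (Suc m)) (u $ j)"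
    and u: "u \<in> open_in_coord j"
  shows "partial_differentiable j F' u"
    and "partial_deriv j F' u = mixed_difference (UNIV - {j}) (($) u) (P m) (u $ j)"
proof -
  let ?D = "mixed_difference (UNIV - {j}) (($) u) (P (Suc m))"
  have "F' (coord_line j u t) = ?D t" if "coord_line j u t \<in> open_in_coord j" for t
    using F'[OF that] by simp (rule mixed_difference_cong, simp)
  then have "\<forall>\<^sub>F t in nhds (u $ j). F' (coord_line j u t) = ?D t"
    using eventually_coord_line_open_in_coord[of u j j] u
    by (auto elim!: eventually_mono)
  moreover have "(?D has_real_derivative
                   mixed_difference (UNIV - {j}) (($) u) (P m) (u $ j)) (at (u $ j))"
    by (intro DERIV_mixed_difference P_Suc)
  ultimately show "partial_differentiable j F' u"
    and "partial_deriv j F' u = mixed_difference (UNIV - {j}) (($) u) (P m) (u $ j)"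
    by (rule partial_derivI)+
qed

lemma second_partial_deriv_distinct:
  fixes F' :: "real ^ 'n::finite \<Rightarrow> real"
  assumes F': "\<And>u. u \<in> open_in_coord j \<Longrightarrow>
                 F' u = mixed_difference (UNIV - {j}) (($) u) (P (Suc m)) (u $ j)"
    and u: "u \<in> open_in_coord i \<inter> open_in_coord j" and "i \<noteq> j"
  shows "partial_differentiable i F' u"
    and "partial_deriv i F' u = mixed_difference (UNIV - {i, j}) (($) u) (P m) (u $ i + u $ j)"
proof -
  let ?D = "mixed_difference (UNIV - {i, j}) (($) u) (P (Suc m))"
  have ij: "UNIV - {j} = insert i (UNIV - {i, j})"
    using \<open>i \<noteq> j\<close> by auto
  have "F' v = ?D (v $ i + u $ j) - ?D (u $ j)"
    if "v = coord_line i u t" "v \<in> open_in_coord j" for v t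
  proof -
    have vj: "v $ j = u $ j"
      using that(1) \<open>i \<noteq> j\<close> by simp
    have "F' v = mixed_difference (UNIV - {i, j}) (($) v) (P (Suc m)) (v $ j + v $ i) -
                 mixed_difference (UNIV - {i, j}) (($) v) (P (Suc m)) (v $ j)"
      unfolding F'[OF that(2)] ij by (subst mixed_difference_insert) simp_all
    also have "\<dots> = ?D (v $ j + v $ i) - ?D (v $ j)"
      using that(1) by (intro arg_cong2[where f = "(-)"] mixed_difference_cong) auto
    finally show ?thesis
      by (simp add: vj add.commute)
  qed
  then have "\<forall>\<^sub>F t in nhds (u $ i). F' (coord_line i u t) = ?D (t + u $ j) - ?D (u $ j)"
    using eventually_coord_line_open_in_coord[OF u]
    by (auto elim!: eventually_mono)
  moreover have "((\<lambda>t. ?D (t + u $ j)) has_real_derivative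
      mixed_difference (UNIV - {i, j}) (($) u) (P m) (u $ i + u $ j)) (at (u $ i))"
    using DERIV_mixed_difference[OF P_Suc] by (subst DERIV_shift [symmetric])
  then have "((\<lambda>t. ?D (t + u $ j) - ?D (u $ j)) has_real_derivative
      mixed_difference (UNIV - {i, j}) (($) u) (P m) (u $ i + u $ j)) (at (u $ i))"
    by (auto intro!: derivative_eq_intros)
  ultimately show "partial_differentiable i F' u"
    and "partial_deriv i F' u = mixed_difference (UNIV - {i, j}) (($) u) (P m) (u $ i + u $ j)"
    by (rule partial_derivI)+
qed

text \<open>
  The conclusion holds for every function that on the unit cube agrees with a mixed difference
  of \<open>P (d - 1)\<close> over all \<open>d\<close> coordinates.
\<close>
theorem partial_derivs_of_mixed_difference:
  fixes F :: "real ^ 'n::finite \<Rightarrow> real"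
  assumes d: "CARD('n) \<ge> 2"
    and F: "\<And>u. (\<And>k. u $ k \<in> {0..1}) \<Longrightarrow>
              F u = mixed_difference UNIV (($) u) (P (CARD('n) - 1)) 0"
  shows "\<forall>j. (\<forall>u\<in>open_in_coord j. partial_differentiable j F u) \<and>
              continuous_on (open_in_coord j) (partial_deriv j F)"
    and "CARD('n) \<ge> 3 \<longrightarrow>
           (\<forall>i j. (\<forall>u\<in>open_in_coord i \<inter> open_in_coord j.
                     partial_differentiable i (partial_deriv j F) u \<and>
                     \<bar>partial_deriv i (partial_deriv j F) u\<bar> \<le> 1) \<and>
                  continuous_on (open_in_coord i \<inter> open_in_coord j)
                    (partial_deriv i (partial_deriv j F)))"
proof -
  have F: "F u = mixed_difference UNIV (($) u) (P (Suc (CARD('n) - 2))) 0"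
    if "\<And>k. u $ k \<in> {0..1}" for u
    using F[OF that] d by (simp add: Suc_diff_Suc numeral_2_eq_2)
  note first = partial_deriv_of_mixed_difference[OF F]
  note cont = continuous_on_mixed_difference[OF P_cont] continuous_intros
  show "\<forall>j. (\<forall>u\<in>open_in_coord j. partial_differentiable j F u) \<and>
            continuous_on (open_in_coord j) (partial_deriv j F)"
  proof (intro allI conjI ballI)
    fix j :: 'n
    show "continuous_on (open_in_coord j) (partial_deriv j F)"
      by (subst continuous_on_cong[OF refl first(2)]) (auto intro!: cont)
  qed (rule first(1))
  show "CARD('n) \<ge> 3 \<longrightarrow>
           (\<forall>i j. (\<forall>u\<in>open_in_coord i \<inter> open_in_coord j.
                     partial_differentiable i (partial_deriv j F) u \<and>
                     \<bar>partial_deriv i (partial_deriv j F) u\<bar> \<le> 1) \<and>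
                  continuous_on (open_in_coord i \<inter> open_in_coord j)
                    (partial_deriv i (partial_deriv j F)))"
  proof (intro impI allI)
    fix i j :: 'n
    assume d3: "CARD('n) \<ge> 3"
    have F': "partial_deriv j F u =
                mixed_difference (UNIV - {j}) (($) u) (P (Suc (CARD('n) - 3))) (u $ j)"
      if "u \<in> open_in_coord j" for u
      using first(2)[OF _ that] d3 by (simp add: Suc_diff_Suc numeral_eq_Suc)
    have bounds: "mixed_difference (UNIV - {i, j}) (($) u) (P (CARD('n) - 3)) x \<in> {0..1}"
      if "i \<noteq> j" "u \<in> open_in_coord i" "0 \<le> x" for i j :: 'n and u x
      using that d3
      by (intro mixed_difference_bounds) (auto simp: card_Diff_subset open_in_coord_def)
    show "(\<forall>u\<in>open_in_coord i \<inter> open_in_coord j.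
             partial_differentiable i (partial_deriv j F) u \<and>
             \<bar>partial_deriv i (partial_deriv j F) u\<bar> \<le> 1) \<and>
          continuous_on (open_in_coord i \<inter> open_in_coord j) (partial_deriv i (partial_deriv j F))"
    proof (cases "i = j")
      case True
      note second = second_partial_deriv_same[OF F']
      \<comment> \<open>Splitting off the difference in another coordinate \<open>l\<close> leaves two mixed differences over
        \<open>d - 2\<close> coordinates, to which the bound applies.\<close>
      obtain l where "l \<noteq> j"
        using d3 by (metis UNIV_I card_1_singleton_iff is_singletonI' is_singleton_altdef
            numeral_le_one_iff semiring_norm(70) UNIV_not_empty)
      then have lj: "UNIV - {j} = insert l (UNIV - {l, j})"
        by auto
      have "\<bar>partial_deriv j (partial_deriv j F) u\<bar> \<le> 1" if u: "u \<in> open_in_coord j" for u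
      proof -
        let ?D = "mixed_difference (UNIV - {l, j}) (($) u) (P (CARD('n) - 3))"
        have ul: "u \<in> open_in_coord j" "0 \<le> u $ l" "0 \<le> u $ j"
          using u by (auto simp: open_in_coord_def)
        have "partial_deriv j (partial_deriv j F) u = ?D (u $ j + u $ l) - ?D (u $ j)"
          unfolding second(2)[OF _ u, simplified] lj by (subst mixed_difference_insert) simp_all
        moreover have "?D (u $ j + u $ l) \<in> {0..1}" "?D (u $ j) \<in> {0..1}"
          using bounds[of j l u] ul \<open>l \<noteq> j\<close> by (auto simp: insert_commute)
        ultimately show ?thesis
          by (auto simp: abs_le_iff)
      qed
      then show ?thesis
        unfolding True Int_absorb
        by (subst continuous_on_cong[OF refl second(2)]) (auto intro!: second(1) cont)
    next
      case False
      note second = second_partial_deriv_distinct[OF F' _ False]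
      have "\<bar>partial_deriv i (partial_deriv j F) u\<bar> \<le> 1"
        if u: "u \<in> open_in_coord i \<inter> open_in_coord j" for u
        using bounds[OF False, of u "u $ i + u $ j"] u second(2)[OF _ u]
        by (auto simp: open_in_coord_def)
      then show ?thesis
        by (subst continuous_on_cong[OF refl second(2)]) (auto intro!: second(1) cont)
    qed
  qed
qed

end

section \<open>Integrals over boxes of functions of the coordinate sum\<close>

lemma Basis_vec_eq_range_axis: "(Basis :: (real ^ 'n) set) = range (\<lambda>j. axis j 1)"
  by (auto simp: Basis_vec_def)

lemma inj_axis_one: "inj (\<lambda>j. axis j (1 :: real))"
  by (auto simp: inj_on_def axis_eq_axis)

lemma sum_nth_eq_sum_Basis: "(\<Sum>j\<in>UNIV. v $ j) = (\<Sum>b\<in>Basis. v \<bullet> b)" for v :: "real ^ 'n::finite"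
  by (simp add: Basis_vec_eq_range_axis sum.reindex[OF inj_axis_one] inner_axis)

lemma nn_integral_lborel_PiM:
  fixes g :: "'a::euclidean_space \<Rightarrow> ennreal"
  assumes [measurable]: "g \<in> borel_measurable borel"
  shows "(\<integral>\<^sup>+v. g v \<partial>lborel) = (\<integral>\<^sup>+x. g (\<Sum>b\<in>Basis. x b *\<^sub>R b) \<partial>(\<Pi>\<^sub>M b\<in>Basis. lborel))"
  by (subst lborel_eq) (simp add: nn_integral_distr)

text \<open>
  The base point \<open>c\<close> is needed for the induction: after the coordinate \<open>a\<close> is fixed
  to \<open>y\<close>, the remaining integral has base point \<open>c + y\<close>.
\<close>
lemma (in primitive_chain) nn_integral_box_sum:
  fixes h :: "real \<Rightarrow> real"
  assumes h [measurable]: "h \<in> borel_measurable borel"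
    and P_0: "\<And>x w. 0 \<le> x \<Longrightarrow> 0 \<le> w \<Longrightarrow> w \<le> 1 \<Longrightarrow>
                (\<integral>\<^sup>+y. indicator {0..w} y * ennreal (h (x + y)) \<partial>lborel) = ennreal (P 0 (x + w) - P 0 x)"
    and "finite I" "card I = Suc k" "\<And>i. i \<in> I \<Longrightarrow> w i \<in> {0..1}" "0 \<le> c"
  shows "(\<integral>\<^sup>+x. (\<Prod>i\<in>I. indicator {0..w i} (x i)) * ennreal (h (c + (\<Sum>i\<in>I. x i)))
             \<partial>(\<Pi>\<^sub>M i\<in>I. lborel)) = ennreal (mixed_difference I w (P k) c)"
  using assms(3-)
proof (induction k arbitrary: I c)
  case 0
  interpret product_sigma_finite "\<lambda>_. lborel :: real measure"
    by standard
  obtain a where "I = {a}"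
    using 0 by (auto simp: card_Suc_eq)
  then show ?case
    using 0 product_nn_integral_singleton[of "\<lambda>y. indicator {0..w a} y * ennreal (h (c + y))" a] P_0[of c "w a"]
    by (simp add: mixed_difference_insert)
next
  case (Suc k)
  interpret product_sigma_finite "\<lambda>_. lborel :: real measure"
    by standard
  obtain a B where I: "I = insert a B" "a \<notin> B" "card B = Suc k" "finite B"
    using Suc.prems(1,2) by (metis card_Suc_eq finite_insert)
  have wa: "0 \<le> w a" "w a \<le> 1"
    using Suc.prems(3)[of a] I by auto
  let ?D = "\<lambda>k y. mixed_difference B w (P k) (c + y)"
  have deriv: "(?D (Suc k) has_real_derivative ?D k y) (at y)" for y
    using DERIV_mixed_difference[OF P_Suc, of B w k "c + y"] DERIV_shift[of _ _ y c]
    by (simp add: add.commute)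
  have cont: "continuous_on UNIV (?D k)"
    by (intro continuous_on_mixed_difference[OF P_cont] continuous_intros)
  have "(\<integral>\<^sup>+x. (\<Prod>i\<in>I. indicator {0..w i} (x i)) * ennreal (h (c + (\<Sum>i\<in>I. x i))) \<partial>(\<Pi>\<^sub>M i\<in>I. lborel)) =
        (\<integral>\<^sup>+y. (\<integral>\<^sup>+x. (\<Prod>i\<in>I. indicator {0..w i} ((x(a := y)) i)) *
              ennreal (h (c + (\<Sum>i\<in>I. (x(a := y)) i))) \<partial>(\<Pi>\<^sub>M i\<in>B. lborel)) \<partial>lborel)"
    unfolding I(1) using I by (intro product_nn_integral_insert_rev) auto
  also have "\<dots> = (\<integral>\<^sup>+y. ennreal (?D k y) * indicator {0..w a} y \<partial>lborel)"
  proof (rule nn_integral_cong)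
    fix y :: real
    have "(\<Prod>i\<in>I. indicator {0..w i} ((x(a := y)) i)) * ennreal (h (c + (\<Sum>i\<in>I. (x(a := y)) i))) =
          indicator {0..w a} y * ((\<Prod>i\<in>B. indicator {0..w i} (x i)) *
             ennreal (h (c + y + (\<Sum>i\<in>B. x i))))" for x :: "'a \<Rightarrow> real"
    proof -
      have "(\<Prod>i\<in>B. indicator {0..w i} ((x(a := y)) i)) = (\<Prod>i\<in>B. indicator {0..w i} (x i) :: ennreal)"
        and "(\<Sum>i\<in>B. (x(a := y)) i) = (\<Sum>i\<in>B. x i)"
        using I(2) by (auto intro!: prod.cong sum.cong)
      then show ?thesis
        using I by (simp add: mult.assoc add.assoc)
    qed
    then have "(\<integral>\<^sup>+x. (\<Prod>i\<in>I. indicator {0..w i} ((x(a := y)) i)) *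
              ennreal (h (c + (\<Sum>i\<in>I. (x(a := y)) i))) \<partial>(\<Pi>\<^sub>M i\<in>B. lborel)) =
          indicator {0..w a} y * (\<integral>\<^sup>+x. (\<Prod>i\<in>B. indicator {0..w i} (x i)) *
             ennreal (h (c + y + (\<Sum>i\<in>B. x i))) \<partial>(\<Pi>\<^sub>M i\<in>B. lborel))"
      by (simp add: nn_integral_cmult)
    also have "\<dots> = ennreal (?D k y) * indicator {0..w a} y"
      using Suc.IH[of B "c + y"] Suc.prems I by (auto simp: indicator_def)
    finally show "(\<integral>\<^sup>+x. (\<Prod>i\<in>I. indicator {0..w i} ((x(a := y)) i)) *
              ennreal (h (c + (\<Sum>i\<in>I. (x(a := y)) i))) \<partial>(\<Pi>\<^sub>M i\<in>B. lborel)) = \<dots>" .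
  qed
  also have "\<dots> = ennreal (?D (Suc k) (w a) - ?D (Suc k) 0)"
  proof (rule nn_integral_FTC_Icc)
    show "?D k \<in> borel_measurable borel"
      using cont by (rule borel_measurable_continuous_onI)
    fix y assume "y \<in> {0..w a}"
    then show "0 \<le> ?D k y"
      using mixed_difference_bounds[of B k w "c + y"] I Suc.prems by auto
    show "(?D (Suc k) has_real_derivative ?D k y) (at y)"
      by (rule deriv)
  qed (use wa in simp)
  also have "?D (Suc k) (w a) - ?D (Suc k) 0 = mixed_difference I w (P (Suc k)) c"
    using I by (simp add: mixed_difference_insert)
  finally show ?case .
qed

text \<open>
  A set of values that is null on the line is also null for the coordinate sum, because already
  the integral in one coordinate vanishes.  This allows a density to be changed
  on a null set.
\<close>
lemma AE_sum_notin_null_set: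
  assumes "Z \<in> null_sets lborel"
  shows "AE v :: real ^ 'n::finite in lborel. (\<Sum>j\<in>UNIV. v $ j) \<notin> Z"
proof -
  interpret product_sigma_finite "\<lambda>_. lborel :: real measure"
    by standard
  have [measurable]: "Z \<in> sets borel"
    using assms by auto
  obtain a B where B: "(Basis :: (real ^ 'n) set) = insert a B" "a \<notin> B" "finite B"
    by (metis finite_Basis finite_insert nonempty_Basis mk_disjoint_insert ex_in_conv)
  have line: "(\<integral>\<^sup>+y. indicator Z (y + s) \<partial>lborel) = 0" for s
  proof -
    have "(\<integral>\<^sup>+y. indicator Z (y + s) \<partial>lborel) = (\<integral>\<^sup>+y. indicator Z y \<partial>lborel)"
      using nn_integral_real_affine[of "indicator Z" 1 s] by (simp add: add.commute)
    then show ?thesis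
      using assms by auto
  qed
  have "(\<integral>\<^sup>+v. indicator Z (\<Sum>b\<in>Basis. v \<bullet> b) \<partial>(lborel :: (real ^ 'n) measure)) =
        (\<integral>\<^sup>+x. indicator Z (\<Sum>b\<in>(Basis :: (real ^ 'n) set). x b) \<partial>(\<Pi>\<^sub>M b\<in>(Basis :: (real ^ 'n) set). lborel))"
    by (subst nn_integral_lborel_PiM) simp_all
  also have "\<dots> = (\<integral>\<^sup>+x. (\<integral>\<^sup>+y. indicator Z (\<Sum>b\<in>insert a B. (x(a := y)) b) \<partial>lborel) \<partial>(\<Pi>\<^sub>M b\<in>B. lborel))"
    unfolding B(1) using B by (intro product_nn_integral_insert) auto
  also have "\<dots> = (\<integral>\<^sup>+x. (\<integral>\<^sup>+y. indicator Z (y + (\<Sum>b\<in>B. x b)) \<partial>lborel) \<partial>(\<Pi>\<^sub>M b\<in>B. lborel))"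
  proof -
    have "(\<Sum>b\<in>insert a B. (x(a := y)) b) = y + (\<Sum>b\<in>B. x b)" for x :: "real ^ 'n \<Rightarrow> real" and y
    proof -
      have "(\<Sum>b\<in>B. (x(a := y)) b) = (\<Sum>b\<in>B. x b)"
        using B(2) by (auto intro!: sum.cong)
      then show ?thesis
        using B(2,3) by simp
    qed
    then show ?thesis
      by simp
  qed
  also have "\<dots> = 0"
    by (simp add: line)
  finally have "AE v :: real ^ 'n in lborel. indicator Z (\<Sum>b\<in>Basis. v \<bullet> b) = (0 :: ennreal)"
    by (subst (asm) nn_integral_0_iff_AE) simp_all
  then show ?thesis
    by (simp add: sum_nth_eq_sum_Basis indicator_def split: if_splits)
qed

section \<open>Periodic extension of a density\<close>

text \<open>A density is finite almost everywhere, so it has a real-valued Borel version.\<close>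
lemma unit_density_borel_version:
  assumes "f \<in> unit_densities"
  obtains \<phi> :: "real \<Rightarrow> real" where
    "\<phi> \<in> borel_measurable borel" "\<And>x. 0 \<le> \<phi> x" "(\<phi> has_integral 1) {0..1}"
    "AE x in lborel. x \<in> {0..1} \<longrightarrow> f x = ennreal (\<phi> x)"
proof -
  let ?f = "\<lambda>x. f x * indicator {0..1} x"
  have "?f \<in> borel_measurable lebesgue" and int_f: "(\<integral>\<^sup>+x. ?f x \<partial>lebesgue) = 1"
    using assms by (simp_all add: unit_densities_def borel_measurable_restrict_space_iff_ennreal
        nn_integral_restrict_space)
  then obtain g where g [measurable]: "g \<in> borel_measurable borel" and fg: "AE x in lborel. ?f x = g x"
    using completion_ex_borel_measurable[of ?f lborel] by auto
  have int_g: "(\<integral>\<^sup>+x. g x \<partial>lborel) = 1"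
    using int_f nn_integral_cong_AE[OF fg] by (simp add: nn_integral_completion)
  have fin: "AE x in lborel. g x \<noteq> \<infinity>"
    by (intro nn_integral_PInf_AE) (simp_all add: int_g)
  define \<phi> where "\<phi> = (\<lambda>x. enn2real (g x) * indicator {0..1} x)"
  have \<phi> [measurable]: "\<phi> \<in> borel_measurable borel"
    unfolding \<phi>_def by measurable
  have "AE x in lborel. g x = ennreal (\<phi> x)"
    using fg fin by eventually_elim (auto simp: \<phi>_def indicator_def top.not_eq_extremum split: if_splits)
  then have "(\<integral>\<^sup>+x. ennreal (\<phi> x) \<partial>lborel) = 1"
    using int_g nn_integral_cong_AE[of g "\<lambda>x. ennreal (\<phi> x)" lborel] by simp
  then have "(\<phi> has_integral 1) UNIV"
    by (intro nn_integral_has_integral) (simp_all add: \<phi>_def)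
  moreover have "\<phi> = (\<lambda>x. if x \<in> {0..1} then \<phi> x else 0)"
    by (auto simp: \<phi>_def fun_eq_iff)
  ultimately have "(\<phi> has_integral 1) {0..1}"
    using has_integral_restrict_UNIV[of "{0..1}" \<phi> 1] by simp
  moreover have "AE x in lborel. x \<in> {0..1} \<longrightarrow> f x = ennreal (\<phi> x)"
    using fg fin by eventually_elim (auto simp: \<phi>_def top.not_eq_extremum)
  ultimately show ?thesis
    using that[of \<phi>] by (simp add: \<phi>_def)
qed

lemma has_integral_comp_frac:
  fixes \<phi> :: "real \<Rightarrow> real"
  assumes "(\<phi> has_integral I) {0..1}"
  shows "((\<lambda>s. \<phi> (frac s)) has_integral I) {of_int k..of_int k + 1}"
proof -
  have "((\<lambda>s. \<phi> (frac s)) has_integral I) {0..1}"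
    using assms by (rule has_integral_spike_finite[of "{1}", rotated 2]) (auto simp: frac_eq)
  moreover have "(\<lambda>s. \<phi> (frac s)) \<circ> (+) (of_int k) = (\<lambda>s. \<phi> (frac s))"
    by (simp add: fun_eq_iff frac_add_int_left)
  ultimately show ?thesis
    using has_integral_shift_Icc_real[of "\<lambda>s. \<phi> (frac s)" "of_int k" I 0 1]
    by (simp add: add.commute)
qed

lemma integrable_comp_frac:
  fixes \<phi> :: "real \<Rightarrow> real"
  assumes "(\<phi> has_integral I) {0..1}" "0 \<le> x"
  shows "(\<lambda>s. \<phi> (frac s)) integrable_on {x..y}"
proof -
  have "(\<lambda>s. \<phi> (frac s)) integrable_on {0..real n}" for n
  proof (induction n)
    case (Suc n)
    have "(\<lambda>s. \<phi> (frac s)) integrable_on {real n..real (Suc n)}"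
      using has_integral_comp_frac[OF assms(1), of "int n"]
      by (auto simp: add.commute integrable_on_def)
    then show ?case
      using Suc Henstock_Kurzweil_Integration.integrable_combine[of 0 "real n" "real (Suc n)" "\<lambda>s. \<phi> (frac s)"] by simp
  qed (use integrable_on_refl[of _ 0] in simp)
  moreover obtain n where "y \<le> real n"
    using real_arch_simple by blast
  ultimately show ?thesis
    using assms(2) by (intro integrable_subinterval_real[of _ 0 "real n" x y]) auto
qed

text \<open>
  The upper bound holds because the integral over an interval of length \<open>1\<close> is \<open>I\<close>: cut at the
  integer inside it, the interval rearranges to a full period.
\<close>
lemma integral_comp_frac_bounds:
  fixes \<phi> :: "real \<Rightarrow> real"
  assumes \<phi>: "(\<phi> has_integral I) {0..1}" "\<And>x. 0 \<le> \<phi> x" and x: "0 \<le> x" and w: "0 \<le> w" "w \<le> 1"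
  shows "integral {x..x + w} (\<lambda>s. \<phi> (frac s)) \<in> {0..I}"
proof -
  define h where "h = (\<lambda>s. \<phi> (frac s))"
  have int [simp]: "h integrable_on {a..b}" if "0 \<le> a" for a b
    using integrable_comp_frac[OF \<phi>(1) that] by (simp add: h_def)
  define k where "k = \<lfloor>x\<rfloor>"
  have k: "0 \<le> real_of_int k" "real_of_int k \<le> x" "x \<le> real_of_int k + 1"
    using x by (simp_all add: k_def)
  have shift: "integral {of_int k..x} h = integral {of_int k + 1..x + 1} h"
  proof -
    have "h \<circ> (+) 1 = h"
      by (simp add: fun_eq_iff h_def frac_1_eq add.commute)
    then show ?thesis
      using integral_shift_Icc_real[of "of_int k" x h 1] by simp
  qed
  have "integral {x..x + w} h \<le> integral {x..x + 1} h"
    using x w \<phi>(2) by (intro integral_subset_le) (auto simp: h_def[symmetric], simp add: h_def)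
  also have "\<dots> = integral {x..of_int k + 1} h + integral {of_int k + 1..x + 1} h"
    using k x by (intro Henstock_Kurzweil_Integration.integral_combine[symmetric]) auto
  also have "\<dots> = integral {of_int k..x} h + integral {x..of_int k + 1} h"
    by (simp add: shift)
  also have "\<dots> = integral {of_int k..of_int k + 1} h"
    using k by (intro Henstock_Kurzweil_Integration.integral_combine) auto
  also have "\<dots> = I"
    using has_integral_comp_frac[OF \<phi>(1), of k] by (simp add: h_def integral_unique)
  finally show ?thesis
    using integral_nonneg[OF int[OF x]] \<phi>(2) by (simp add: h_def)
qed

text \<open>
  Iterated primitives of \<open>F\<close>, with arbitrary constants of integration (a mixed difference over at
  least \<open>k\<close> coordinates does not depend on those chosen up to step \<open>k\<close>).  The
  choice is meaningful for continuous \<open>F\<close>.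
\<close>
primrec primitives :: "(real \<Rightarrow> real) \<Rightarrow> nat \<Rightarrow> real \<Rightarrow> real" where
  "primitives F 0 = F"
| "primitives F (Suc k) = (SOME G. \<forall>x. (G has_real_derivative primitives F k x) (at x))"

lemma DERIV_primitives:
  assumes "continuous_on UNIV F"
  shows "(primitives F (Suc k) has_real_derivative primitives F k x) (at x)"
proof -
  have prim: "\<forall>x. (primitives F (Suc k) has_real_derivative primitives F k x) (at x)"
    if "continuous_on UNIV (primitives F k)" for k
  proof -
    have "\<exists>G. \<forall>x. (G has_real_derivative primitives F k x) (at x)"
      using einterval_antiderivative[of "-\<infinity>" "\<infinity>" "primitives F k"] that
      by (simp add: continuous_on_eq_continuous_at has_real_derivative_iff_has_vector_derivative)
    then show ?thesis
      unfolding primitives.simps(2) by (rule someI_ex)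
  qed
  have "continuous_on UNIV (primitives F k)"
  proof (induction k)
    case (Suc k)
    then show ?case
      using prim by (blast intro: DERIV_continuous_on DERIV_subset)
  qed (use assms in simp)
  then show ?thesis
    using prim by blast
qed

text \<open>
  Truncation at \<open>0\<close> gives a function continuous on the whole line although \<open>h\<close> is considered
  only on the nonnegative half-line.
\<close>
lemma continuous_on_integral_max:
  fixes h :: "real \<Rightarrow> real"
  assumes "\<And>b. h integrable_on {0..b}"
  shows "continuous_on UNIV (\<lambda>x. integral {0..max 0 x} h)"
  unfolding continuous_on_eq_continuous_at[OF open_UNIV]
proof
  fix x :: real
  have "continuous_on {0..max 0 x + 1} (\<lambda>y. integral {0..y} h)"
    by (intro indefinite_integral_continuous_1 assms)
  then have "continuous_on {..<x + 1} (\<lambda>y. integral {0..max 0 y} h)"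
    by (rule continuous_on_compose2) (auto intro!: continuous_intros)
  then show "isCont (\<lambda>x. integral {0..max 0 x} h) x"
    by (subst (asm) continuous_on_eq_continuous_at) auto
qed
section \<open>The generated copula\<close>

text \<open>The copula is the mixed difference of an iterated primitive of the periodic extension.\<close>
lemma generated_copula_eq_mixed_difference:
  assumes f: "f \<in> unit_densities"
  obtains P where "primitive_chain P"
    and "\<And>u :: real ^ 'n::finite. (\<And>k. u $ k \<in> {0..1}) \<Longrightarrow>
           generated_copula f u = mixed_difference UNIV (($) u) (P (CARD('n) - 1)) 0"
proof -
  obtain \<phi> :: "real \<Rightarrow> real" where \<phi>_borel [measurable]: "\<phi> \<in> borel_measurable borel"
    and \<phi>_nonneg: "\<And>x. 0 \<le> \<phi> x" and \<phi>_int: "(\<phi> has_integral 1) {0..1}"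
    and f_\<phi>: "AE x in lborel. x \<in> {0..1} \<longrightarrow> f x = ennreal (\<phi> x)"
    using unit_density_borel_version[OF f] by blast
  define h where "h = (\<lambda>s. \<phi> (frac s))"
  have h [measurable]: "h \<in> borel_measurable borel"
    unfolding h_def frac_def by measurable
  have h_nonneg: "0 \<le> h s" for s
    by (simp add: h_def \<phi>_nonneg)
  have h_int: "h integrable_on {x..y}" if "0 \<le> x" for x y
    using integrable_comp_frac[OF \<phi>_int that] by (simp add: h_def)
  define F where "F = (\<lambda>x. integral {0..max 0 x} h)"
  define P where "P = primitives F"
  have F_diff: "F (x + w) - F x = integral {x..x + w} h" if "0 \<le> x" "0 \<le> w" for x w
    using Henstock_Kurzweil_Integration.integral_combine[of 0 x "x + w" h] that h_int
    by (simp add: F_def)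
  have F_cont: "continuous_on UNIV F"
    unfolding F_def using h_int by (intro continuous_on_integral_max) simp
  interpret primitive_chain P
  proof
    show "(P (Suc k) has_real_derivative P k x) (at x)" for k x
      unfolding P_def by (intro DERIV_primitives F_cont)
    show "P 0 (x + w) - P 0 x \<in> {0..1}" if "0 \<le> x" "0 \<le> w" "w \<le> 1" for x w
      using integral_comp_frac_bounds[OF \<phi>_int \<phi>_nonneg that] that
      by (simp add: P_def F_diff h_def)
  qed (simp add: P_def F_cont)
  have P_0: "(\<integral>\<^sup>+y. indicator {0..w} y * ennreal (h (x + y)) \<partial>lborel) = ennreal (P 0 (x + w) - P 0 x)"
    if "0 \<le> x" "0 \<le> w" for x w
  proof -
    have "(h has_integral integral {x..x + w} h) {x..x + w}"
      using h_int[OF that(1)] by (rule integrable_integral)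
    then have "((\<lambda>y. h (x + y)) has_integral integral {x..x + w} h) {0..w}"
      using has_integral_shift_Icc_real[of h x _ 0 w] by (simp add: o_def add.commute)
    from nn_integral_has_integral_lebesgue'[OF _ this]
    show ?thesis
      using that by (simp add: h_nonneg P_def F_diff mult.commute)
  qed
  have ae: "AE v :: real ^ 'n in lborel. copula_density f v = ennreal (h (\<Sum>j\<in>UNIV. v $ j))"
  proof -
    obtain N where N: "N \<in> null_sets lborel" and "{x. \<not> (x \<in> {0..1} \<longrightarrow> f x = ennreal (\<phi> x))} \<subseteq> N"
      using f_\<phi> by (auto simp: eventually_ae_filter)
    then have eq: "f x = ennreal (\<phi> x)" if "x \<in> {0..1}" "x \<notin> N" for x
      using that by blast
    \<comment> \<open>The translates of \<open>N\<close> by integers cover every \<open>s\<close> with \<open>frac s \<in> N\<close>.\<close>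
    define Z where "Z = (\<Union>k::int. {x. x - of_int k \<in> N})"
    have "Z \<in> null_sets lborel"
      unfolding Z_def by (intro null_sets_UN null_sets_translation N)
    from AE_sum_notin_null_set[OF this] show ?thesis
    proof eventually_elim
      case (elim v)
      define s where "s = (\<Sum>j\<in>UNIV. v $ j)"
      have "frac s \<notin> N"
        using elim by (auto simp: Z_def frac_def s_def)
      moreover have "frac s \<in> {0..1}"
        using frac_lt_1[of s] by simp
      ultimately show ?case
        using eq by (simp add: copula_density_def h_def s_def)
    qed
  qed
  have "generated_copula f u = mixed_difference UNIV (($) u) (P (CARD('n) - 1)) 0"
    if u: "\<And>k. u $ k \<in> {0..1}" for u :: "real ^ 'n"
  proof -
    have u_Basis: "u \<bullet> b \<in> {0..1}" if "b \<in> Basis" for b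
      using that u by (auto simp: Basis_vec_def inner_axis)
    have "(\<integral>\<^sup>+v\<in>cbox 0 u. copula_density f v \<partial>lebesgue) =
          (\<integral>\<^sup>+v. ennreal (h (\<Sum>j\<in>UNIV. v $ j)) * indicator (cbox 0 u) v \<partial>lborel)"
      unfolding nn_integral_completion using ae by (intro nn_integral_cong_AE) auto
    also have "\<dots> = (\<integral>\<^sup>+v. (\<Prod>b\<in>Basis. indicator {0..u \<bullet> b} (v \<bullet> b)) * ennreal (h (\<Sum>b\<in>Basis. v \<bullet> b)) \<partial>lborel)"
    proof (rule nn_integral_cong)
      fix v :: "real ^ 'n"
      have "indicator (cbox 0 u) v = (\<Prod>b\<in>Basis. indicator {0..u \<bullet> b} (v \<bullet> b) :: ennreal)"
      proof (cases "v \<in> cbox 0 u")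
        case True
        then show ?thesis
          by (auto simp: mem_box intro!: prod.neutral[symmetric])
      next
        case False
        then show ?thesis
          by (force simp: mem_box indicator_def intro!: prod_zero[symmetric])
      qed
      then show "ennreal (h (\<Sum>j\<in>UNIV. v $ j)) * indicator (cbox 0 u) v =
            (\<Prod>b\<in>Basis. indicator {0..u \<bullet> b} (v \<bullet> b)) * ennreal (h (\<Sum>b\<in>Basis. v \<bullet> b))"
        by (simp add: sum_nth_eq_sum_Basis mult.commute)
    qed
    \<comment> \<open>The summand \<open>0\<close> is the base point of the box integral.\<close>
    also have "\<dots> = (\<integral>\<^sup>+x. (\<Prod>b\<in>Basis. indicator {0..u \<bullet> b} (x b)) * ennreal (h (0 + (\<Sum>b\<in>(Basis :: (real ^ 'n) set). x b)))
                       \<partial>(\<Pi>\<^sub>M b\<in>Basis. lborel))"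
      by (subst nn_integral_lborel_PiM) simp_all
    also have "\<dots> = ennreal (mixed_difference Basis ((\<bullet>) u) (P (CARD('n) - 1)) 0)"
      using u_Basis by (intro nn_integral_box_sum h P_0) simp_all
    also have "mixed_difference Basis ((\<bullet>) u) (P (CARD('n) - 1)) 0 =
               mixed_difference UNIV (($) u) (P (CARD('n) - 1)) 0"
      by (simp add: Basis_vec_eq_range_axis mixed_difference_image inj_axis_one inner_axis)
    finally show ?thesis
      using mixed_difference_bounds[of "UNIV :: 'n set" "CARD('n) - 1" "($) u" 0] u
      by (simp add: generated_copula_def)
  qed
  with primitive_chain_axioms show ?thesis
    by (rule that)
qed

theorem proposition3:
  fixes f :: "real \<Rightarrow> ennreal"
  assumes "CARD('n::finite) \<ge> 2"
    and "f \<in> unit_densities"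
  defines "C \<equiv> (generated_copula f :: real ^ 'n \<Rightarrow> real)"
  shows "(\<forall>j. (\<forall>u\<in>open_in_coord j. partial_differentiable j C u) \<and>
              continuous_on (open_in_coord j) (partial_deriv j C)) \<and>
         (CARD('n) \<ge> 3 \<longrightarrow>
           (\<forall>i j. (\<forall>u\<in>open_in_coord i \<inter> open_in_coord j.
                     partial_differentiable i (partial_deriv j C) u \<and>
                     \<bar>partial_deriv i (partial_deriv j C) u\<bar> \<le> 1) \<and>
                  continuous_on (open_in_coord i \<inter> open_in_coord j)
                    (partial_deriv i (partial_deriv j C))))"
proof -
  obtain P where "primitive_chain P"
    and C: "\<And>u :: real ^ 'n. (\<And>k. u $ k \<in> {0..1}) \<Longrightarrow>
              C u = mixed_difference UNIV (($) u) (P (CARD('n) - 1)) 0"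
    using generated_copula_eq_mixed_difference[OF assms(2)] unfolding C_def by blast
  then interpret primitive_chain P
    by simp
  show ?thesis
    using partial_derivs_of_mixed_difference[OF assms(1) C] by blast
qed

end
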